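(* For each edit type $\mathrm{edit} \in \{\mathrm{sub}, \mathrm{ins}, \mathrm{del}\}$, $\mathrm{AS}_{\mathrm{edit}}(z_{\mathrm{SSsr}}, n) = O(n^{2/3})$ and $\mathrm{AS}_{\mathrm{edit}}(z_{\mathrm{SS}}, n) = O(n^{2/3})$.
   Context: Strings are finite sequences over an alphabet; $T[i..j]$ is the substring from position $i$ to $j$. In an LZ-style factorization $T=f_1\cdots f_z$ each phrase is either a single fresh character (not occurring earlier in $T$) or a copy of an earlier-occurring substring. Let $s = |f_1\cdots f_{k-1}|+1$ be the start of phrase $f_k$. In the overlapping LZSS factorization, if $T[s]$ does not occur in $T[1..s-1]$ then $f_k=T[s]$, otherwise $f_k$ is the longest prefix of $T[s..n]$ with an occurrence starting at a position $<s$ (overlap with $f_k$ allowed); $z_{\mathrm{SSsr}}(T)$ is its number of phrases. In the non-overlapping LZSS factorization, $f_k$ is a fresh character if $T[s]$ does not occur in $T[1..s-1]$, and otherwise is the longest prefix of $T[s..n]$ that occurs in $T[1..s-1]$; $z_{\mathrm{SS}}(T)$ is its number of phrases. For a measure $c$, $\mathrm{AS}_{\mathrm{edit}}(c,n) = \max\{c(T')-c(T)\}$ over all strings $T$ of length $n$ and all $T'$ obtained from $T$ by a single edit of the given type (substitution, insertion or deletion of one character). *)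

theory Defs
  imports Complex_Main "HOL-Library.Sublist" "HOL-Library.Landau_Symbols"
begin

text \<open>
  Strings are lists over an arbitrary (possibly infinite) alphabet \<open>'a\<close>; positions are
  0-based, so \<open>take s T\<close> is the part of \<open>T\<close> preceding a phrase that starts at position \<open>s\<close>.
\<close>

text \<open>\<open>w\<close> has an occurrence in \<open>T\<close> starting before \<open>s\<close>; it may extend beyond \<open>s\<close>.\<close>
definition occ_overlap :: "'a list \<Rightarrow> nat \<Rightarrow> 'a list \<Rightarrow> bool" where
  "occ_overlap T s w \<longleftrightarrow> (\<exists>i<s. prefix w (drop i T))"

definition occ_nonoverlap :: "'a list \<Rightarrow> nat \<Rightarrow> 'a list \<Rightarrow> bool" where
  "occ_nonoverlap T s w \<longleftrightarrow> sublist w (take s T)"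

definition lzss_phrase ::
    "('a list \<Rightarrow> nat \<Rightarrow> 'a list \<Rightarrow> bool) \<Rightarrow> 'a list \<Rightarrow> nat \<Rightarrow> 'a list" where
  "lzss_phrase occ T s =
     (if T ! s \<notin> set (take s T) then [T ! s]
      else (ARG_MAX length w. prefix w (drop s T) \<and> occ T s w))"

lemma lzss_phrase_longest:
  assumes "T ! s \<in> set (take s T)" "prefix w (drop s T)" "occ T s w"
  shows "prefix (lzss_phrase occ T s) (drop s T)" "occ T s (lzss_phrase occ T s)"
    "length w \<le> length (lzss_phrase occ T s)"
proof -
  let ?P = "\<lambda>w. prefix w (drop s T) \<and> occ T s w"
  have bnd: "\<forall>y. ?P y \<longrightarrow> length y \<le> length T"
    by (auto dest!: prefix_length_le)
  have w: "?P w" using assms by simp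
  have "?P (arg_max length ?P)"
    by (rule arg_max_natI[of ?P w length "Suc (length T)"]) (use w bnd in auto)
  moreover have "length w \<le> length (arg_max length ?P)"
    by (rule arg_max_nat_le[of ?P w length "Suc (length T)"]) (use w bnd in auto)
  ultimately show "prefix (lzss_phrase occ T s) (drop s T)" "occ T s (lzss_phrase occ T s)"
    "length w \<le> length (lzss_phrase occ T s)"
    using assms(1) by (simp_all add: lzss_phrase_def)
qed

lemma prefix_singleton_drop: "s < length T \<Longrightarrow> prefix [T ! s] (drop s T)"
  by (simp flip: Cons_nth_drop_Suc)

lemma occ_overlap_single:
  assumes "s < length T" "T ! s \<in> set (take s T)"
  shows "occ_overlap T s [T ! s]"
proof -
  obtain i where "i < s" "T ! i = T ! s"
    using assms by (auto simp: in_set_conv_nth)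
  then show ?thesis
    using prefix_singleton_drop[of i T] assms(1) unfolding occ_overlap_def by auto
qed

lemma occ_nonoverlap_single:
  assumes "T ! s \<in> set (take s T)"
  shows "occ_nonoverlap T s [T ! s]"
  using assms unfolding occ_nonoverlap_def sublist_def by (fastforce dest: split_list)

lemma lzss_phrase_nonempty:
  assumes "s < length T" "T ! s \<in> set (take s T) \<Longrightarrow> occ T s [T ! s]"
  shows "lzss_phrase occ T s \<noteq> []"
proof (cases "T ! s \<in> set (take s T)")
  case True
  have "length [T ! s] \<le> length (lzss_phrase occ T s)"
    using True prefix_singleton_drop[OF assms(1)] assms(2)[OF True] by (rule lzss_phrase_longest(3))
  then show ?thesis by auto
qed (simp add: lzss_phrase_def)

lemmas lzss_phrase_overlap_nonempty =
  lzss_phrase_nonempty[of _ _ occ_overlap, OF _ occ_overlap_single]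
lemmas lzss_phrase_nonoverlap_nonempty =
  lzss_phrase_nonempty[of _ _ occ_nonoverlap, OF _ occ_nonoverlap_single]

text \<open>The suffix \<open>sr\<close> (self-referential) marks the variant whose copies may overlap their source.\<close>

function lzss_sr_from :: "'a list \<Rightarrow> nat \<Rightarrow> 'a list list" where
  "lzss_sr_from T s =
     (if s < length T
      then (let f = lzss_phrase occ_overlap T s in f # lzss_sr_from T (s + length f))
      else [])"
  by pat_completeness auto
termination
  by (relation "measure (\<lambda>(T, s). length T - s)")
     (auto simp: lzss_phrase_overlap_nonempty intro!: diff_less_mono2)

function lzss_from :: "'a list \<Rightarrow> nat \<Rightarrow> 'a list list" where
  "lzss_from T s =
     (if s < length T
      then (let f = lzss_phrase occ_nonoverlap T s in f # lzss_from T (s + length f))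
      else [])"
  by pat_completeness auto
termination
  by (relation "measure (\<lambda>(T, s). length T - s)")
     (auto simp: lzss_phrase_nonoverlap_nonempty intro!: diff_less_mono2)

declare lzss_sr_from.simps [simp del] lzss_from.simps [simp del]

definition z_SSsr :: "'a list \<Rightarrow> nat" where
  "z_SSsr T = length (lzss_sr_from T 0)"

definition z_SS :: "'a list \<Rightarrow> nat" where
  "z_SS T = length (lzss_from T 0)"

datatype edit = Sub | Ins | Del

fun edited :: "edit \<Rightarrow> 'a list \<Rightarrow> 'a list set" where
  "edited Sub T = {T[i := c] | i c. i < length T \<and> c \<noteq> T ! i}"
| "edited Ins T = {take i T @ c # drop i T | i c. i \<le> length T}"
| "edited Del T = {take i T @ drop (Suc i) T | i. i < length T}"

definition sensitivity_diffs :: "edit \<Rightarrow> ('a list \<Rightarrow> nat) \<Rightarrow> nat \<Rightarrow> int set" where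
  "sensitivity_diffs e c n = {int (c T') - int (c T) | T T'. length T = n \<and> T' \<in> edited e T}"

text \<open>
  For the two measures below the set of differences is finite even over an infinite alphabet
  (see \<open>finite_sensitivity_diffs_z_SSsr\<close>, \<open>finite_sensitivity_diffs_z_SS\<close>), so the maximum is
  genuine. The set is empty only if there is no edit at all, i.e. for substitution or deletion
  with \<open>n = 0\<close>, and for substitution over a one-letter alphabet; \<open>Max {}\<close> is then some fixed,
  unspecified integer independent of \<open>n\<close>.
\<close>
definition AS :: "edit \<Rightarrow> ('a list \<Rightarrow> nat) \<Rightarrow> nat \<Rightarrow> int" where
  "AS e c n = Max (sensitivity_diffs e c n)"

lemma length_lzss_sr_from_le: "length (lzss_sr_from T s) \<le> length T - s"
proof (induction T s rule: lzss_sr_from.induct)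
  case (1 T s)
  show ?case
  proof (cases "s < length T")
    case True
    from 1[OF True refl] lzss_phrase_overlap_nonempty[OF True True] True show ?thesis
      by (subst lzss_sr_from.simps) (cases "lzss_phrase occ_overlap T s"; auto simp: Let_def)
  qed (simp add: lzss_sr_from.simps)
qed

lemma length_lzss_from_le: "length (lzss_from T s) \<le> length T - s"
proof (induction T s rule: lzss_from.induct)
  case (1 T s)
  show ?case
  proof (cases "s < length T")
    case True
    from 1[OF True refl] lzss_phrase_nonoverlap_nonempty[OF True] True show ?thesis
      by (subst lzss_from.simps) (cases "lzss_phrase occ_nonoverlap T s"; auto simp: Let_def)
  qed (simp add: lzss_from.simps)
qed

lemma length_edited_le: "T' \<in> edited e T \<Longrightarrow> length T' \<le> Suc (length T)"
  by (cases e) auto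

lemma finite_sensitivity_diffs:
  assumes "\<And>T. c T \<le> length T"
  shows "finite (sensitivity_diffs e c n)"
proof (rule finite_subset)
  show "sensitivity_diffs e c n \<subseteq> {- int n .. int n + 1}"
  proof
    fix d assume "d \<in> sensitivity_diffs e c n"
    then obtain T T' where "d = int (c T') - int (c T)" "length T = n" "T' \<in> edited e T"
      unfolding sensitivity_diffs_def by blast
    then show "d \<in> {- int n .. int n + 1}"
      using assms[of T] assms[of T'] length_edited_le[of T' e T] by auto
  qed
qed simp

lemma finite_sensitivity_diffs_z_SSsr: "finite (sensitivity_diffs e z_SSsr n)"
  by (rule finite_sensitivity_diffs) (use length_lzss_sr_from_le[of _ 0] in \<open>simp add: z_SSsr_def\<close>)

lemma finite_sensitivity_diffs_z_SS: "finite (sensitivity_diffs e z_SS n)"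
  by (rule finite_sensitivity_diffs) (use length_lzss_from_le[of _ 0] in \<open>simp add: z_SS_def\<close>)

end

theory Submission imports Defs begin

text \<open>
  Write \<open>T = A X B\<close> and \<open>T' = A Y B\<close> with \<open>|X|, |Y| \<le> 1\<close>. A phrase of \<open>T\<close> lying in \<open>B\<close> whose source
  avoids the edit can still be copied in \<open>T'\<close>, so by greediness at most one phrase of \<open>T'\<close> starts
  inside it; if the source touches the edit, splitting the phrase there leaves boundedly many starts.
  Hence \<open>z(T') - z(T)\<close> is at most a constant plus twice the number of bad phrases, those all of whose
  sources touch the edit. Bad phrases are pairwise distinct strings, since an earlier equal phrase
  would be an unaffected source, and only \<open>l\<close> distinct strings of length \<open>l\<close> occur across the edit.
  As the lengths of phrases add up to at most \<open>n\<close>, there are at most \<open>L\<^sup>2 + n / L\<close> bad phrases for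
  every \<open>L\<close>; take \<open>L\<close> close to the cube root of \<open>n\<close>. Edits are symmetric in \<open>X\<close> and \<open>Y\<close>, which gives
  the lower bound on the difference.
\<close>

text \<open>The flag \<open>ov\<close> says whether a copy may overlap its source.\<close>

definition copy_at :: "bool \<Rightarrow> 'a list \<Rightarrow> nat \<Rightarrow> nat \<Rightarrow> nat \<Rightarrow> bool" where
  "copy_at ov T u i l \<longleftrightarrow>
     i < u \<and> (ov \<or> i + l \<le> u) \<and> u + l \<le> length T \<and> (\<forall>k<l. T ! (i + k) = T ! (u + k))"

text \<open>\<open>S\<close> is the set of start positions of phrases and \<open>g u\<close> the length of the phrase at \<open>u\<close>.\<close>
definition greedy_parse :: "bool \<Rightarrow> 'a list \<Rightarrow> nat set \<Rightarrow> (nat \<Rightarrow> nat) \<Rightarrow> bool" where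
  "greedy_parse ov T S g \<longleftrightarrow>
     S \<subseteq> {..<length T} \<and>
     (\<forall>u\<in>S. 1 \<le> g u \<and> u + g u \<le> length T \<and> (g u = 1 \<or> (\<exists>i. copy_at ov T u i (g u)))
        \<and> (\<forall>i l. copy_at ov T u i l \<longrightarrow> l \<le> g u)) \<and>
     (\<forall>u\<in>S. \<forall>v\<in>S. u < v \<longrightarrow> u + g u \<le> v) \<and>
     (\<forall>p<length T. \<exists>u\<in>S. u \<le> p \<and> p < u + g u)"

section \<open>Both factorizations as greedy parses\<close>

lemma copy_at_sub:
  assumes "copy_at ov T u i l" "k + m \<le> l"
  shows "copy_at ov T (u + k) (i + k) m"
  using assms unfolding copy_at_def by (auto simp: add.assoc)

lemma prefix_iff_nth:
  "prefix w xs \<longleftrightarrow> length w \<le> length xs \<and> (\<forall>k<length w. w ! k = xs ! k)"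
  unfolding prefix_def
  by (metis append_take_drop_id length_append le_add1 nth_append nth_take_lemma take_all_iff
      order_refl take_append append_eq_conv_conj)

lemma occ_overlap_iff_copy_at:
  assumes "prefix w (drop s T)" "s < length T" "w \<noteq> []"
  shows "occ_overlap T s w \<longleftrightarrow> (\<exists>i. copy_at True T s i (length w))"
proof -
  have "prefix w (drop i T) \<longleftrightarrow> (\<forall>k<length w. T ! (i + k) = T ! (s + k))" if "i < s" for i
    using assms that by (auto simp: prefix_iff_nth)
  moreover have "s + length w \<le> length T"
    using assms by (auto simp: prefix_iff_nth)
  ultimately show ?thesis
    unfolding occ_overlap_def copy_at_def by auto
qed

lemma sublist_iff_nth:
  "sublist w xs \<longleftrightarrow>
     (\<exists>i. i + length w \<le> length xs \<and> (\<forall>k<length w. w ! k = xs ! (i + k)))"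
proof
  assume "sublist w xs"
  then obtain ps ss where "xs = ps @ w @ ss" unfolding sublist_def by blast
  then show "\<exists>i. i + length w \<le> length xs \<and> (\<forall>k<length w. w ! k = xs ! (i + k))"
    by (intro exI[of _ "length ps"]) (auto simp: nth_append)
next
  assume "\<exists>i. i + length w \<le> length xs \<and> (\<forall>k<length w. w ! k = xs ! (i + k))"
  then obtain i where i: "i + length w \<le> length xs" "\<forall>k<length w. w ! k = xs ! (i + k)" by blast
  then have "prefix w (drop i xs)" by (auto simp: prefix_iff_nth)
  then show "sublist w xs"
    by (meson prefix_imp_sublist sublist_drop sublist_order.order_trans)
qed

lemma occ_nonoverlap_iff_copy_at:
  assumes "prefix w (drop s T)" "s < length T" "w \<noteq> []"
  shows "occ_nonoverlap T s w \<longleftrightarrow> (\<exists>i. copy_at False T s i (length w))"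
proof -
  have *: "s + length w \<le> length T" "\<forall>k<length w. w ! k = T ! (s + k)"
    using assms by (auto simp: prefix_iff_nth)
  have lt: "i < s" if "i + length w \<le> s" for i
    using that assms(3) by (cases w) auto
  have "occ_nonoverlap T s w \<longleftrightarrow> (\<exists>i. i + length w \<le> s \<and> (\<forall>k<length w. w ! k = T ! (i + k)))"
    using assms(2) unfolding occ_nonoverlap_def sublist_iff_nth by auto
  also have "\<dots> \<longleftrightarrow> (\<exists>i. copy_at False T s i (length w))"
    using * lt unfolding copy_at_def by (intro ex_cong1) auto
  finally show ?thesis .
qed

text \<open>Collects what the counting needs to know about a phrase, expressed through
  \<open>copy_at\<close> alone, so that a single argument serves both factorizations. A fresh
  character is the case \<open>l = 1\<close> in which no source need exist.\<close>

lemma lzss_phrase_greedy: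
  assumes occ: "\<And>w. prefix w (drop s T) \<Longrightarrow> w \<noteq> [] \<Longrightarrow>
      occ T s w \<longleftrightarrow> (\<exists>i. copy_at ov T s i (length w))"
    and single: "T ! s \<in> set (take s T) \<Longrightarrow> occ T s [T ! s]"
    and s: "s < length T"
  defines "l \<equiv> length (lzss_phrase occ T s)"
  shows "1 \<le> l" "s + l \<le> length T" "l = 1 \<or> (\<exists>i. copy_at ov T s i l)"
    "copy_at ov T s i m \<Longrightarrow> m \<le> l"
proof -
  have ne: "lzss_phrase occ T s \<noteq> []"
    using s single by (rule lzss_phrase_nonempty)
  then show "1 \<le> l" unfolding l_def by (cases "lzss_phrase occ T s") auto
  show "s + l \<le> length T"
  proof (cases "T ! s \<in> set (take s T)")
    case True
    have "prefix (lzss_phrase occ T s) (drop s T)"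
      using True prefix_singleton_drop[OF s] single[OF True] by (rule lzss_phrase_longest)
    then show ?thesis using s by (auto simp: l_def dest: prefix_length_le)
  qed (use s in \<open>simp add: l_def lzss_phrase_def\<close>)
  show "l = 1 \<or> (\<exists>i. copy_at ov T s i l)"
  proof (cases "T ! s \<in> set (take s T)")
    case True
    note ph = lzss_phrase_longest(1,2)[of T s "[T ! s]" occ,
      OF True prefix_singleton_drop[OF s] single[OF True]]
    then show ?thesis using occ[OF ph(1) ne] by (simp add: l_def)
  qed (simp add: l_def lzss_phrase_def)
  show "m \<le> l" if c: "copy_at ov T s i m"
  proof (cases "m = 0")
    case False
    let ?w = "take m (drop s T)"
    have m: "i < s" "s + m \<le> length T" "T ! i = T ! s"
      using c False unfolding copy_at_def by (auto dest: spec[of _ 0])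
    then have w: "length ?w = m" "prefix ?w (drop s T)" "?w \<noteq> []"
      using False s by (auto simp: take_is_prefix)
    \<comment> \<open>The first character of a nonempty copy already occurs before \<open>s\<close>,
      so the phrase is not a fresh character.\<close>
    have "T ! s \<in> set (take s T)"
      using m s by (metis in_set_conv_nth length_take min.absorb4 nth_take)
    moreover have "occ T s ?w"
      using occ[OF w(2,3)] c w(1) by auto
    ultimately show ?thesis
      using lzss_phrase_longest(3)[OF _ w(2)] w(1) unfolding l_def by metis
  qed simp
qed

text \<open>\<open>F\<close> stands for the number of phrases from \<open>s\<close> on and
  \<open>g\<close> for the phrase length. Collecting the arguments of the recursive calls turns the
  recursive count into the cardinality of a set of starts, for both factorizations at once.\<close>

lemma chain_of_recursion:
  fixes F g :: "nat \<Rightarrow> nat"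
  assumes F: "\<And>s. F s = (if s < n then Suc (F (s + g s)) else 0)"
    and g: "\<And>s. s < n \<Longrightarrow> 1 \<le> g s"
  shows "\<exists>S. S \<subseteq> {s..<n} \<and> card S = F s \<and> (\<forall>u\<in>S. \<forall>v\<in>S. u < v \<longrightarrow> u + g u \<le> v)
     \<and> (\<forall>p. s \<le> p \<and> p < n \<longrightarrow> (\<exists>u\<in>S. u \<le> p \<and> p < u + g u))"
proof (induction "n - s" arbitrary: s rule: less_induct)
  case less
  show ?case
  proof (cases "s < n")
    case False
    then show ?thesis using F[of s] by (intro exI[of _ "{}"]) auto
  next
    case True
    then have gs: "1 \<le> g s" using g by blast
    then have "n - (s + g s) < n - s" using True by auto
    from less[OF this] obtain S where S: "S \<subseteq> {s + g s..<n}" "card S = F (s + g s)"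
      "\<forall>u\<in>S. \<forall>v\<in>S. u < v \<longrightarrow> u + g u \<le> v"
      "\<And>p. s + g s \<le> p \<Longrightarrow> p < n \<Longrightarrow> \<exists>u\<in>S. u \<le> p \<and> p < u + g u" by auto
    have "finite S" using S(1) by (rule finite_subset) simp
    moreover have "s \<notin> S" using S(1) gs by auto
    ultimately have "card (insert s S) = F s" using F[of s] True S(2) by simp
    moreover have "insert s S \<subseteq> {s..<n}" using S(1) True by auto
    moreover have "\<forall>u\<in>insert s S. \<forall>v\<in>insert s S. u < v \<longrightarrow> u + g u \<le> v"
      using S(1,3) by fastforce
    moreover have "\<exists>u\<in>insert s S. u \<le> p \<and> p < u + g u" if "s \<le> p" "p < n" for p
      using S(4)[of p] that by (cases "p < s + g s") auto
    ultimately show ?thesis by blast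
  qed
qed

lemma greedy_parse_z_SSsr: "\<exists>S g. greedy_parse True T S g \<and> card S = z_SSsr T"
proof -
  let ?g = "\<lambda>s. length (lzss_phrase occ_overlap T s)"
  note ph = lzss_phrase_greedy[of _ T occ_overlap True,
      OF occ_overlap_iff_copy_at occ_overlap_single, simplified]
  have "\<exists>S. S \<subseteq> {0..<length T} \<and> card S = length (lzss_sr_from T 0)
     \<and> (\<forall>u\<in>S. \<forall>v\<in>S. u < v \<longrightarrow> u + ?g u \<le> v)
     \<and> (\<forall>p. 0 \<le> p \<and> p < length T \<longrightarrow> (\<exists>u\<in>S. u \<le> p \<and> p < u + ?g u))"
    by (rule chain_of_recursion, subst lzss_sr_from.simps, simp add: Let_def) (simp add: ph)
  then obtain S where S: "S \<subseteq> {0..<length T}" "card S = length (lzss_sr_from T 0)"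
    "\<forall>u\<in>S. \<forall>v\<in>S. u < v \<longrightarrow> u + ?g u \<le> v" "\<forall>p<length T. \<exists>u\<in>S. u \<le> p \<and> p < u + ?g u"
    by auto
  have "greedy_parse True T S ?g"
    unfolding greedy_parse_def
    using S(1,3,4) ph by (auto simp: Suc_le_eq subset_iff)
  then show ?thesis using S(2) unfolding z_SSsr_def by blast
qed

lemma greedy_parse_z_SS: "\<exists>S g. greedy_parse False T S g \<and> card S = z_SS T"
proof -
  let ?g = "\<lambda>s. length (lzss_phrase occ_nonoverlap T s)"
  note ph = lzss_phrase_greedy[of _ T occ_nonoverlap False,
      OF occ_nonoverlap_iff_copy_at occ_nonoverlap_single, simplified]
  have "\<exists>S. S \<subseteq> {0..<length T} \<and> card S = length (lzss_from T 0)
     \<and> (\<forall>u\<in>S. \<forall>v\<in>S. u < v \<longrightarrow> u + ?g u \<le> v)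
     \<and> (\<forall>p. 0 \<le> p \<and> p < length T \<longrightarrow> (\<exists>u\<in>S. u \<le> p \<and> p < u + ?g u))"
    by (rule chain_of_recursion, subst lzss_from.simps, simp add: Let_def) (simp add: ph)
  then obtain S where S: "S \<subseteq> {0..<length T}" "card S = length (lzss_from T 0)"
    "\<forall>u\<in>S. \<forall>v\<in>S. u < v \<longrightarrow> u + ?g u \<le> v" "\<forall>p<length T. \<exists>u\<in>S. u \<le> p \<and> p < u + ?g u"
    by auto
  have "greedy_parse False T S ?g"
    unfolding greedy_parse_def
    using S(1,3,4) ph by (auto simp: Suc_le_eq subset_iff)
  then show ?thesis using S(2) unfolding z_SS_def by blast
qed

section \<open>Counting by separating positions\<close>

text \<open>Send each \<open>t\<close> to the largest cut not exceeding it, which exists because of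
  the cut 0. A cut separating \<open>s\<close> from \<open>t\<close> makes this map strictly
  increasing on \<open>P\<close>.\<close>

lemma card_le_card_cuts:
  fixes P Q :: "nat set"
  assumes "finite Q" "0 \<in> Q"
    and sep: "\<And>s t. s \<in> P \<Longrightarrow> t \<in> P \<Longrightarrow> s < t \<Longrightarrow> \<exists>q\<in>Q. s < q \<and> q \<le> t"
  shows "card P \<le> card Q"
proof (rule card_inj_on_le)
  let ?f = "\<lambda>t. Max {q \<in> Q. q \<le> t}"
  have f: "?f t \<in> Q" "?f t \<le> t" for t
  proof -
    have "?f t \<in> {q \<in> Q. q \<le> t}" using assms(1,2) by (intro Max_in) auto
    then show "?f t \<in> Q" "?f t \<le> t" by auto
  qed
  have "?f s < ?f t" if st: "s \<in> P" "t \<in> P" "s < t" for s t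
  proof -
    obtain q where "q \<in> Q" "s < q" "q \<le> t" using sep st by blast
    then have "q \<le> ?f t" using assms(1) by (intro Max_ge) auto
    then show ?thesis using f(2)[of s] \<open>s < q\<close> by linarith
  qed
  then show "inj_on ?f P"
    by (metis (no_types, lifting) linorder_inj_onI' less_irrefl)
  show "?f ` P \<subseteq> Q" using f(1) by blast
qed fact

section \<open>Copies that survive a single edit\<close>

text \<open>The assumptions are symmetric in the two strings, so the locale can be interpreted once
  in each direction.\<close>

locale single_edit =
  fixes A X Y B :: "'a list" and ov :: bool and S S' :: "nat set" and g g' :: "nat \<Rightarrow> nat"
  assumes X: "length X \<le> 1" and Y: "length Y \<le> 1"
    and parse: "greedy_parse ov (A @ X @ B) S g"
    and parse': "greedy_parse ov (A @ Y @ B) S' g'"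
begin

abbreviation "T \<equiv> A @ X @ B"
abbreviation "T' \<equiv> A @ Y @ B"
abbreviation "a \<equiv> length A"
abbreviation "x \<equiv> length X"
abbreviation "y \<equiv> length Y"

lemma fin: "finite S"
  using parse finite_subset unfolding greedy_parse_def by blast

lemma phraseD:
  assumes "u \<in> S"
  shows "1 \<le> g u" "u + g u \<le> length T" "g u = 1 \<or> (\<exists>i. copy_at ov T u i (g u))"
  using parse assms unfolding greedy_parse_def by blast+

lemma phrase_disjoint: "u \<in> S \<Longrightarrow> v \<in> S \<Longrightarrow> u < v \<Longrightarrow> u + g u \<le> v"
  using parse unfolding greedy_parse_def by blast

lemma phrase_cover: "p < length T \<Longrightarrow> \<exists>u\<in>S. u \<le> p \<and> p < u + g u"
  using parse unfolding greedy_parse_def by blast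

lemma phrase_next:
  assumes "u \<in> S" "u + g u < length T"
  shows "u + g u \<in> S"
proof -
  obtain v where v: "v \<in> S" "v \<le> u + g u" "u + g u < v + g v"
    using phrase_cover assms(2) by blast
  then show ?thesis
    using phrase_disjoint[of u v] phrase_disjoint[of v u] assms(1)
    by (cases u v rule: linorder_cases) auto
qed

text \<open>Length \<open>t - s + 1\<close> covers \<open>t\<close> itself, so by greediness the
  phrase at \<open>s\<close> would swallow the start \<open>t\<close>.\<close>

lemma no_copy_between_starts:
  assumes "s \<in> S'" "t \<in> S'" "s < t"
  shows "\<not> copy_at ov T' s i (t - s + 1)"
proof
  assume "copy_at ov T' s i (t - s + 1)"
  then have "t - s + 1 \<le> g' s" using parse' assms(1) unfolding greedy_parse_def by blast
  moreover have "s + g' s \<le> t" using parse' assms unfolding greedy_parse_def by blast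
  ultimately show False by linarith
qed

text \<open>Since \<open>i < u\<close>, the source ends before \<open>a\<close> as well, and neither
  block meets the edit.\<close>

lemma copy_before_edit:
  assumes "copy_at ov T u i l" "u + l \<le> a"
  shows "copy_at ov T' u i l"
  using assms unfolding copy_at_def by (auto simp: nth_append)

lemma nth_after_edit: "a + x \<le> p \<Longrightarrow> T ! p = T' ! (p - x + y)"
  by (auto simp: nth_append not_less add.commute)

text \<open>A source left of the edit stays in place; one to its right moves together with the
  target.\<close>

lemma copy_after_edit:
  assumes c: "copy_at ov T u i l" and u: "a + x \<le> u" and l: "0 < l"
    and i: "i + l \<le> a \<or> a + x \<le> i"
  shows "\<exists>i'. copy_at ov T' (u - x + y) i' l"
proof -
  have len: "u - x + y + l \<le> length T'" using c u unfolding copy_at_def by auto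
  have eq: "T ! (u + k) = T' ! (u - x + y + k)" for k
    using nth_after_edit[of "u + k"] u by (metis Nat.add_diff_assoc2 add.assoc add.commute add_leD2 trans_le_add1)
  from i show ?thesis
  proof
    assume i: "i + l \<le> a"
    have "T ! (i + k) = T' ! (i + k)" if "k < l" for k
      using i that by (simp add: nth_append)
    then have "copy_at ov T' (u - x + y) i l"
      using c u l i len eq unfolding copy_at_def by auto
    then show ?thesis ..
  next
    assume i: "a + x \<le> i"
    have "T ! (i + k) = T' ! (i - x + y + k)" for k
      using nth_after_edit[of "i + k"] i by (metis Nat.add_diff_assoc2 add.assoc add.commute add_leD2 trans_le_add1)
    then have "copy_at ov T' (u - x + y) (i - x + y) l"
      using c u i len eq unfolding copy_at_def by auto
    then show ?thesis ..
  qed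
qed

section \<open>Bad phrases and the cuts they cause\<close>

definition "src u = (SOME i. copy_at ov T u i (g u))"

lemma src: "u \<in> S \<Longrightarrow> g u \<noteq> 1 \<Longrightarrow> copy_at ov T u (src u) (g u)"
  unfolding src_def using phraseD(3)[of u] by (auto intro: someI_ex)

definition "Bad = {u \<in> S. a + x \<le> u \<and> g u \<noteq> 1 \<and>
  (\<forall>i. copy_at ov T u i (g u) \<longrightarrow> \<not> (i + g u \<le> a \<or> a + x \<le> i))}"

text \<open>At most one phrase starts before the end of \<open>X\<close> and reaches into \<open>B\<close>.\<close>
definition "Edge = {u \<in> S. u < a + x \<and> a + x < u + g u}"

definition "shift p = (if p < a then p else if p < a + x then a else p - x + y)"

text \<open>
  Positions of \<open>T'\<close> separating any two starts of its phrases: the images of the phrase boundaries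
  of \<open>T\<close>, the borders of the edit, and, for each phrase that may lack an unaffected source, the two
  positions aligned with the borders of the edit in the chosen source.
\<close>
definition "Cuts = {0, a, a + y} \<union> shift ` S
  \<union> (\<lambda>u. u + (a - src u) - x + y) ` (Bad \<union> Edge)
  \<union> (\<lambda>u. u + (a + x - src u) - x + y) ` (Bad \<union> Edge)"

lemma shift_in_Cuts: "u \<in> S \<Longrightarrow> shift u \<in> Cuts"
  unfolding Cuts_def by blast

text \<open>Without a cut, \<open>s\<close> and \<open>t\<close> lie in one phrase of
  \<open>T\<close>. The piece of its source facing \<open>s\<close> to \<open>t\<close> survives the
  edit, contradicting greediness in \<open>T'\<close>.\<close>

lemma cut_before_edit:
  assumes st: "s \<in> S'" "t \<in> S'" "s < t" "t < a"
  shows "\<exists>q\<in>Cuts. s < q \<and> q \<le> t"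
proof (rule ccontr)
  assume no: "\<not> ?thesis"
  obtain u where u: "u \<in> S" "u \<le> s" "s < u + g u"
    using phrase_cover[of s] st by auto
  have "t < u + g u"
  proof (rule ccontr)
    assume "\<not> t < u + g u"
    then have "u + g u \<in> S" "shift (u + g u) = u + g u"
      using phrase_next[OF u(1)] st by (auto simp: shift_def)
    then have "u + g u \<in> Cuts" using shift_in_Cuts by metis
    then show False using no u(3) \<open>\<not> t < u + g u\<close> by auto
  qed
  then have "copy_at ov T (u + (s - u)) (src u + (s - u)) (t - s + 1)"
    using u st by (intro copy_at_sub[OF src]) auto
  then have "copy_at ov T' s (src u + (s - u)) (t - s + 1)"
    using u st by (intro copy_before_edit) auto
  then show False using no_copy_between_starts st by blast
qed

lemma cut_after_edit:
  assumes st: "s \<in> S'" "t \<in> S'" "s < t" "a + y \<le> s"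
  shows "\<exists>q\<in>Cuts. s < q \<and> q \<le> t"
proof (rule ccontr)
  assume no: "\<not> ?thesis"
  \<comment> \<open>The positions of \<open>T\<close> that correspond to \<open>s\<close> and
    \<open>t\<close>.\<close>
  define s0 t0 where "s0 = s - y + x" and "t0 = t - y + x"
  have 0: "s = s0 - x + y" "t = t0 - x + y" "a + x \<le> s0" "s0 < t0" "t0 - s0 = t - s"
    unfolding s0_def t0_def using st by auto
  have "t < length T'" using parse' st unfolding greedy_parse_def by auto
  then have t0: "t0 < length T" using st unfolding t0_def by auto
  obtain u where u: "u \<in> S" "u \<le> s0" "s0 < u + g u"
    using phrase_cover[of s0] 0 t0 by auto
  have tu: "t0 < u + g u"
  proof (rule ccontr)
    assume "\<not> t0 < u + g u"
    then have "u + g u \<in> S" "shift (u + g u) = u + g u - x + y"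
      using phrase_next[OF u(1)] t0 0 u by (auto simp: shift_def)
    then have "u + g u - x + y \<in> Cuts" using shift_in_Cuts by metis
    then show False using no u(3) 0 \<open>\<not> t0 < u + g u\<close> by auto
  qed
  then have g1: "g u \<noteq> 1" using u 0 by auto
  \<comment> \<open>For every source, the piece facing \<open>s0\<close> to \<open>t0\<close>
    touches the edit, since otherwise it could be copied in \<open>T'\<close>. Having this for all
    sources is what puts \<open>u\<close> into \<open>Bad\<close> or \<open>Edge\<close>.\<close>
  have cross: "i + (s0 - u) < a + x" "a < i + (s0 - u) + (t0 - s0 + 1)"
    if "copy_at ov T u i (g u)" for i
  proof -
    have "copy_at ov T (u + (s0 - u)) (i + (s0 - u)) (t0 - s0 + 1)"
      using u 0 tu by (intro copy_at_sub[OF that]) auto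
    then have "copy_at ov T s0 (i + (s0 - u)) (t0 - s0 + 1)" using u by simp
    from copy_after_edit[OF this 0(3)] no_copy_between_starts[OF st(1-3)]
    show "i + (s0 - u) < a + x" "a < i + (s0 - u) + (t0 - s0 + 1)"
      using 0 by (metis add_gr_0 less_one not_le)+
  qed
  have "u \<in> Bad \<union> Edge"
  proof (cases "u < a + x")
    case True
    then show ?thesis using u 0 by (auto simp: Edge_def)
  next
    case False
    have "\<not> (i + g u \<le> a \<or> a + x \<le> i)" if "copy_at ov T u i (g u)" for i
      using cross[OF that] tu u 0 by linarith
    then show ?thesis using u g1 False by (auto simp: Bad_def)
  qed
  then have "u + (a - src u) - x + y \<in> Cuts" "u + (a + x - src u) - x + y \<in> Cuts"
    unfolding Cuts_def by blast+
  then have "\<not> (s < u + (a - src u) - x + y \<and> u + (a - src u) - x + y \<le> t)"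
    "\<not> (s < u + (a + x - src u) - x + y \<and> u + (a + x - src u) - x + y \<le> t)"
    using no by blast+
  then have cuts: "\<not> (s0 < u + (a - src u) \<and> u + (a - src u) \<le> t0)"
    "\<not> (s0 < u + (a + x - src u) \<and> u + (a + x - src u) \<le> t0)"
    using 0(1-4) by linarith+
  note cr = cross[OF src[OF u(1) g1]]
  obtain k where k: "s0 = u + k" using u(2) le_Suc_ex by blast
  show False
  \<comment> \<open>If the source piece starts before \<open>a\<close>, the cut aligned with
    \<open>a\<close> separates \<open>s0\<close> from \<open>t0\<close>. Otherwise
    \<open>x = 1\<close> and it starts exactly at \<open>a\<close>, so the other cut is
    \<open>s0 + 1\<close>.\<close>
  proof (cases "src u + k < a")
    case True
    then show ?thesis using cuts(1) cr k 0 by auto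
  next
    case False
    then show ?thesis using cuts(2) cr k 0 X by auto
  qed
qed

lemma card_parse_le_cuts: "card S' \<le> card Cuts"
proof (rule card_le_card_cuts)
  have "Bad \<subseteq> S" "Edge \<subseteq> S" by (auto simp: Bad_def Edge_def)
  then have "finite (Bad \<union> Edge)" using fin finite_subset by blast
  then show "finite Cuts" using fin unfolding Cuts_def by blast
  show "0 \<in> Cuts" by (simp add: Cuts_def)
  have in_Cuts: "a \<in> Cuts" "a + y \<in> Cuts" by (simp_all add: Cuts_def)
  fix s t assume st: "s \<in> S'" "t \<in> S'" "s < t"
  \<comment> \<open>Pairs on both sides of \<open>a\<close> or of \<open>a + y\<close> are separated
    by that cut, and the fourth case is void because \<open>y\<close> is at most 1.\<close>
  consider "t < a" | "s < a" "a \<le> t" | "s < a + y" "a + y \<le> t" | "a \<le> s" "t < a + y" | "a + y \<le> s"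
    by linarith
  then show "\<exists>q\<in>Cuts. s < q \<and> q \<le> t"
    using cut_before_edit[OF st] cut_after_edit[OF st] in_Cuts st Y by cases auto
qed

section \<open>Counting edge phrases and bad phrases\<close>

lemma card_Edge: "card Edge \<le> 1"
proof -
  have "u = v" if "u \<in> Edge" "v \<in> Edge" for u v
    using that phrase_disjoint[of u v] phrase_disjoint[of v u]
    unfolding Edge_def by (cases u v rule: linorder_cases) auto
  moreover have "finite Edge" using fin by (simp add: Edge_def)
  ultimately show ?thesis by (simp add: card_le_Suc0_iff_eq)
qed

text \<open>Length and offset of \<open>a\<close> within the source determine the source, hence the
  phrase as a string, and the offset is smaller than the length.\<close>

lemma card_short_Bad: "card {u \<in> Bad. g u \<le> L} \<le> L * L"
proof -
  let ?f = "\<lambda>u. (g u, a - src u)"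
  have c: "copy_at ov T u (src u) (g u)" "src u \<le> a" "a < src u + g u" "a + x \<le> u" "u \<in> S"
    if "u \<in> Bad" for u
    using that src[of u] X unfolding Bad_def by fastforce+
  have neq: "?f u \<noteq> ?f v" if "u \<in> Bad" "v \<in> Bad" "u < v" for u v
  proof
    assume "?f u = ?f v"
    then have e: "g u = g v" "src u = src v" using c(2)[OF that(1)] c(2)[OF that(2)] by auto
    have "u + g u \<le> v" using phrase_disjoint c that by blast
    \<comment> \<open>The earlier phrase is itself a source of the later one. It ends by
      \<open>v\<close>, so it is valid for either value of \<open>ov\<close>, and it lies wholly
      behind the edit, which badness of \<open>v\<close> forbids.\<close>
    then have "copy_at ov T v u (g v)"
      using c(1)[OF that(1)] c(1)[OF that(2)] e \<open>u < v\<close> unfolding copy_at_def by auto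
    then show False using that c(4) unfolding Bad_def by blast
  qed
  have "card {u \<in> Bad. g u \<le> L} \<le> card ({1..L} \<times> {..<L})"
  proof (rule card_inj_on_le)
    show "inj_on ?f {u \<in> Bad. g u \<le> L}"
      using neq by (intro linorder_inj_onI') blast
    show "?f ` {u \<in> Bad. g u \<le> L} \<subseteq> {1..L} \<times> {..<L}"
      using c phraseD(1) by fastforce
  qed simp
  then show ?thesis by simp
qed

lemma card_long_Bad: "L * card {u \<in> Bad. L < g u} \<le> length T"
proof -
  let ?D = "{u \<in> Bad. L < g u}"
  have sub: "?D \<subseteq> S" by (auto simp: Bad_def)
  then have fD: "finite ?D" using fin finite_subset by blast
  have "L * card ?D = (\<Sum>u\<in>?D. L)" by simp
  also have "\<dots> \<le> (\<Sum>u\<in>?D. card {u..<u + g u})" by (rule sum_mono) auto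
  also have "\<dots> = card (\<Union>u\<in>?D. {u..<u + g u})"
  proof (rule card_UN_disjoint[symmetric, OF fD])
    show "\<forall>u\<in>?D. \<forall>v\<in>?D. u \<noteq> v \<longrightarrow> {u..<u + g u} \<inter> {v..<v + g v} = {}"
    proof (intro ballI impI)
      fix u v assume "u \<in> ?D" "v \<in> ?D" "u \<noteq> v"
      then show "{u..<u + g u} \<inter> {v..<v + g v} = {}"
        using phrase_disjoint[of u v] phrase_disjoint[of v u] sub by fastforce
    qed
  qed simp
  also have "\<dots> \<le> card {..<length T}"
    using phraseD(2) sub by (intro card_mono) (auto dest!: subsetD intro: less_le_trans)
  finally show ?thesis by simp
qed

text \<open>Each phrase in \<open>Bad\<close> or \<open>Edge\<close> contributes two cuts. The
  constant 5 is two cuts for the edge phrase plus the three positions 0, \<open>a\<close> and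
  \<open>a + y\<close>.\<close>

lemma card_parse_le:
  assumes "0 < L"
  shows "card S' \<le> card S + 2 * (L * L) + 2 * (length T div L) + 5"
proof -
  have fB: "finite Bad" "finite Edge" using fin by (simp_all add: Bad_def Edge_def)
  have "Bad = {u \<in> Bad. g u \<le> L} \<union> {u \<in> Bad. L < g u}" by auto
  then have "card Bad \<le> card {u \<in> Bad. g u \<le> L} + card {u \<in> Bad. L < g u}"
    by (metis card_Un_le)
  moreover have "card {u \<in> Bad. L < g u} \<le> length T div L"
    using card_long_Bad[of L] assms by (simp add: less_eq_div_iff_mult_less_eq mult.commute)
  ultimately have BE: "card (Bad \<union> Edge) \<le> L * L + length T div L + 1"
    using card_short_Bad[of L] card_Edge card_Un_le[of Bad Edge] by linarith
  have im: "card (f ` (Bad \<union> Edge)) \<le> card (Bad \<union> Edge)" for f :: "nat \<Rightarrow> nat"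
    using fB by (intro card_image_le) simp
  have "card Cuts \<le> card {0, a, a + y} + card (shift ` S)
      + card ((\<lambda>u. u + (a - src u) - x + y) ` (Bad \<union> Edge))
      + card ((\<lambda>u. u + (a + x - src u) - x + y) ` (Bad \<union> Edge))"
    unfolding Cuts_def by (meson add_mono card_Un_le order_refl order_trans)
  also have "\<dots> \<le> 3 + card S + card (Bad \<union> Edge) + card (Bad \<union> Edge)"
    using fin by (intro add_mono im card_image_le) (auto simp: card_insert_if)
  finally show ?thesis using BE card_parse_le_cuts by linarith
qed

end

section \<open>From edits to the asymptotic bound\<close>

lemma editedE:
  assumes "T' \<in> edited e T"
  obtains A X Y B where "T = A @ X @ B" "T' = A @ Y @ B" "length X \<le> 1" "length Y \<le> 1"
proof (cases e)
  case Sub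
  then obtain i c where "i < length T" "T' = T[i := c]" using assms by auto
  then show ?thesis
    by (intro that[of "take i T" "[T ! i]" "drop (Suc i) T" "[c]"])
      (auto simp: upd_conv_take_nth_drop id_take_nth_drop)
next
  case Ins
  then obtain i c where "i \<le> length T" "T' = take i T @ c # drop i T" using assms by auto
  then show ?thesis by (intro that[of "take i T" "[]" "drop i T" "[c]"]) auto
next
  case Del
  then obtain i where "i < length T" "T' = take i T @ drop (Suc i) T" using assms by auto
  then show ?thesis
    by (intro that[of "take i T" "[T ! i]" "drop (Suc i) T" "[]"]) (auto simp: id_take_nth_drop)
qed

text \<open>Both directions are needed because the O-bound concerns the absolute value;
  \<open>Suc (length T)\<close> dominates both lengths.\<close>

lemma edited_parse_le:
  fixes c :: "'a list \<Rightarrow> nat"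
  assumes parse: "\<And>T. \<exists>S g. greedy_parse ov T S g \<and> card S = c T"
    and "T' \<in> edited e T" "0 < L"
  defines "E \<equiv> 2 * (L * L) + 2 * (Suc (length T) div L) + 5"
  shows "\<bar>int (c T') - int (c T)\<bar> \<le> int E"
proof -
  obtain A X Y B where eq: "T = A @ X @ B" "T' = A @ Y @ B" "length X \<le> 1" "length Y \<le> 1"
    using assms(2) by (rule editedE)
  obtain S g where S: "greedy_parse ov T S g" "card S = c T" using parse by blast
  obtain S' g' where S': "greedy_parse ov T' S' g'" "card S' = c T'" using parse by blast
  interpret fw: single_edit A X Y B ov S S' g g'
    using eq S S' by unfold_locales auto
  interpret bw: single_edit A Y X B ov S' S g' g
    using eq S S' by unfold_locales auto
  have "length T div L \<le> Suc (length T) div L" "length T' div L \<le> Suc (length T) div L"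
    using length_edited_le[OF assms(2)] by (auto intro: div_le_mono)
  then show ?thesis
    using fw.card_parse_le[OF assms(3), folded eq(1,2)] bw.card_parse_le[OF assms(3), folded eq(1,2)]
    unfolding S(2) S'(2) E_def by linarith
qed

lemma cube_root_balance:
  assumes "1 \<le> n"
  obtains L :: nat where "0 < L"
    "real (2 * (L * L) + 2 * (Suc n div L) + 5) \<le> 17 * real n powr (2 / 3)"
proof
  define r where "r = real n powr (1 / 3)"
  \<comment> \<open>Rounding up at most doubles \<open>r\<close>, as \<open>r\<close> is at least 1.
    In units of \<open>r * r\<close> the three summands are then at most 8, 4 and 5, which gives
    17.\<close>
  define L where "L = nat \<lceil>r\<rceil>"
  have r: "1 \<le> r" using assms by (simp add: r_def ge_one_powr_ge_zero)
  have L: "r \<le> real L" "real L \<le> 2 * r" using r unfolding L_def by linarith+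
  show "0 < L" using r L by (cases L) auto
  have r2: "real n powr (2 / 3) = r * r" and r3: "real n = r * r * r"
    using assms by (simp_all add: r_def flip: powr_add)
  have "real (Suc n div L) \<le> real (Suc n) / real L" by (rule of_nat_div_le_of_nat)
  also have "\<dots> \<le> real (2 * n) / r"
    using assms L r by (intro frac_le) auto
  also have "\<dots> = 2 * (r * r)" using r r3 by simp
  finally have "real (Suc n div L) \<le> 2 * (r * r)" .
  moreover have "real L * real L \<le> (2 * r) * (2 * r)" using L r by (intro mult_mono) auto
  moreover have "1 \<le> r * r" using r by (metis mult_mono' mult_1 zero_le_one)
  ultimately show "real (2 * (L * L) + 2 * (Suc n div L) + 5) \<le> 17 * real n powr (2 / 3)"
    unfolding r2 by (simp add: algebra_simps)
qed

lemma AS_bigo: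
  fixes c :: "'a list \<Rightarrow> nat"
  assumes parse: "\<And>T. \<exists>S g. greedy_parse ov T S g \<and> card S = c T"
    and fin: "\<And>n. finite (sensitivity_diffs e c n)"
  shows "(\<lambda>n. real_of_int (AS e c n)) \<in> O(\<lambda>n. real n powr (2 / 3))"
proof (rule bigoI)
  \<comment> \<open>If no edit exists, \<open>AS\<close> is the unspecified integer
    \<open>Max {}\<close>, which the constant has to absorb.\<close>
  let ?K = "17 + \<bar>real_of_int (Max {})\<bar>"
  show "\<forall>\<^sub>F n in at_top. norm (real_of_int (AS e c n)) \<le> ?K * norm (real n powr (2 / 3))"
    using eventually_ge_at_top[of 1]
  proof eventually_elim
    case (elim n)
    let ?N = "real n powr (2 / 3)"
    have N: "1 \<le> ?N" using elim by (simp add: ge_one_powr_ge_zero)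
    show ?case
    proof (cases "sensitivity_diffs e c n = {}")
      case True
      have "\<bar>real_of_int (Max {})\<bar> * 1 \<le> ?K * ?N" using N by (intro mult_mono) auto
      then show ?thesis using True by (simp add: AS_def)
    next
      case False
      then have "AS e c n \<in> sensitivity_diffs e c n" unfolding AS_def using fin by simp
      then obtain T T' where T: "AS e c n = int (c T') - int (c T)" "length T = n" "T' \<in> edited e T"
        unfolding sensitivity_diffs_def by blast
      obtain L where L: "0 < L" "real (2 * (L * L) + 2 * (Suc n div L) + 5) \<le> 17 * ?N"
        using cube_root_balance elim by blast
      have "\<bar>AS e c n\<bar> \<le> int (2 * (L * L) + 2 * (Suc n div L) + 5)"
        using edited_parse_le[OF parse T(3) L(1)] T by simp
      then have "\<bar>real_of_int (AS e c n)\<bar> \<le> real (2 * (L * L) + 2 * (Suc n div L) + 5)"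
        by linarith
      also note L(2)
      also have "17 * ?N \<le> ?K * ?N" using N by (intro mult_right_mono) auto
      finally show ?thesis by simp
    qed
  qed
qed

theorem theorem6:
  fixes e :: edit
  shows "(\<lambda>n. real_of_int (AS e (z_SSsr :: 'a list \<Rightarrow> nat) n)) \<in> O(\<lambda>n. real n powr (2 / 3))
       \<and> (\<lambda>n. real_of_int (AS e (z_SS :: 'a list \<Rightarrow> nat) n)) \<in> O(\<lambda>n. real n powr (2 / 3))"
  using AS_bigo[OF greedy_parse_z_SSsr finite_sensitivity_diffs_z_SSsr]
    AS_bigo[OF greedy_parse_z_SS finite_sensitivity_diffs_z_SS] by blast

end
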